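(* For every $\pi\in\mathfrak{B}_n$, $$\sum_{j,k\ge 0}\binom{2jk+2k+n-1-\mathrm{des}_A(\pi)}{n}s^jt^k=\frac{\sum_{\sigma\tau=\pi}s^{\mathrm{des}_A(\sigma)}t^{\mathrm{ades}(\tau)}}{(1-s)^{n+1}(1-t)^{n+1}}$$ and $$\sum_{j,k\ge 0}\binom{2jk+2j+n-\mathrm{ades}(\pi)}{n}s^jt^k=\frac{\sum_{\sigma\tau=\pi}s^{\mathrm{ades}(\sigma)}t^{\mathrm{des}_A(\tau)}}{(1-s)^{n+1}(1-t)^{n+1}},$$ where the sums on the right are over all pairs $(\sigma,\tau)\in\mathfrak{B}_n\times\mathfrak{B}_n$ with $\sigma\tau=\pi$.
   Context: Let $n\ge 1$. The hyperoctahedral group $\mathfrak{B}_n$ is the group (under composition of functions, $(\sigma\tau)(i)=\sigma(\tau(i))$) of all bijections $\pi$ of $\{-n,\ldots,-1,0,1,\ldots,n\}$ with $\pi(-i)=-\pi(i)$ for all $i$. For $\pi\in\mathfrak{B}_n$, $\mathrm{des}_A(\pi)=|\{i\in\{1,\ldots,n-1\}:\pi(i)>\pi(i+1)\}|$, and the augmented descent number $\mathrm{ades}(\pi)$ is the number of $i\in\{0,1,\ldots,n\}$ with $\pi(i)>\pi(i+1)$, where $\pi(0)=0$ and $\pi(n+1):=0$. The identities are of formal power series in $s,t$. *)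

theory Defs
  imports
    "HOL-Combinatorics.Permutations"
    "HOL-Computational_Algebra.Formal_Power_Series"
begin

text \<open>
  As usual with \<^const>\<open>permutes\<close>, a bijection of \<open>{-n..n}\<close> is represented by the function on
  \<^typ>\<open>int\<close> that extends it by the identity, so that the group multiplication is \<^const>\<open>comp\<close>.
\<close>

definition hyperoctahedral :: "nat \<Rightarrow> (int \<Rightarrow> int) set" where
  "hyperoctahedral n =
     {\<pi>. \<pi> permutes {- int n..int n} \<and> (\<forall>i\<in>{- int n..int n}. \<pi> (- i) = - \<pi> i)}"

definition des_A :: "nat \<Rightarrow> (int \<Rightarrow> int) \<Rightarrow> nat" where
  "des_A n \<pi> = card {i\<in>{1..int n - 1}. \<pi> i > \<pi> (i + 1)}"

text \<open>
  The convention \<open>\<pi>(n + 1) := 0\<close> is imposed by the update, while \<open>\<pi>(0) = 0\<close> holds for all members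
  of the hyperoctahedral group.
\<close>

definition ades :: "nat \<Rightarrow> (int \<Rightarrow> int) \<Rightarrow> nat" where
  "ades n \<pi> = (let \<pi>' = \<pi>(int n + 1 := 0) in card {i\<in>{0..int n}. \<pi>' i > \<pi>' (i + 1)})"

text \<open>
  Power series in \<open>s\<close> and \<open>t\<close> are power series in \<open>t\<close> over the power series in \<open>s\<close>.
\<close>

abbreviation fps_s :: "rat fps fps" where "fps_s \<equiv> fps_const fps_X"
abbreviation fps_t :: "rat fps fps" where "fps_t \<equiv> fps_X"

definition fps2 :: "(nat \<Rightarrow> nat \<Rightarrow> rat) \<Rightarrow> rat fps fps" where
  "fps2 c = Abs_fps (\<lambda>k. Abs_fps (\<lambda>j. c j k))"

definition factorizations ::
    "nat \<Rightarrow> (int \<Rightarrow> int) \<Rightarrow> ((int \<Rightarrow> int) \<times> (int \<Rightarrow> int)) set" where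
  "factorizations n \<pi> =
     {(\<sigma>, \<tau>) \<in> hyperoctahedral n \<times> hyperoctahedral n. \<sigma> \<circ> \<tau> = \<pi>}"

lemma hyperoctahedral_0:
  assumes "\<pi> \<in> hyperoctahedral n"
  shows "\<pi> 0 = 0"
proof -
  have "\<pi> (- 0) = - \<pi> 0"
    using assms unfolding hyperoctahedral_def by force
  then show ?thesis by simp
qed

text \<open>
  The next two bounds show that subtracting descent numbers from \<open>n - 1\<close> and \<open>n\<close>
  respectively never truncates.
\<close>

lemma des_A_le: "des_A n \<pi> \<le> n - 1"
proof -
  have "des_A n \<pi> \<le> card {1..int n - 1}"
    unfolding des_A_def by (rule card_mono) auto
  then show ?thesis by simp
qed

lemma ades_le:
  assumes "\<pi> \<in> hyperoctahedral n"
  shows "ades n \<pi> \<le> n"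
proof -
  define f where "f = \<pi>(int n + 1 := 0)"
  let ?D = "{i\<in>{0..int n}. f i > f (i + 1)}"
  have f0: "f 0 = 0" "f (int n + 1) = 0"
    using hyperoctahedral_0[OF assms] by (auto simp: f_def)
  have "?D \<noteq> {0..int n}"
  proof
    assume D: "?D = {0..int n}"
    have "f (int m + 1) < 0" if "m \<le> n" for m
      using that
    proof (induction m)
      case 0
      have "0 \<in> ?D" by (subst D) auto
      then show ?case using f0 by simp
    next
      case (Suc m)
      have "int m + 1 \<in> ?D" using Suc.prems by (subst D) auto
      then have "f (int m + 1 + 1) < f (int m + 1)" by blast
      then show ?case using Suc by (simp add: algebra_simps)
    qed
    from this[of n] f0 show False by simp
  qed
  then have "card ?D < card {0..int n}"
    by (intro psubset_card_mono) auto
  then show ?thesis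
    unfolding ades_def f_def[symmetric] Let_def by simp
qed

lemma fps2_nth: "fps_nth (fps_nth (fps2 c) k) j = c j k"
  by (simp add: fps2_def)

text \<open>
  Although \<^typ>\<open>rat fps\<close> is not a field, the denominator is a unit, and the library
  division by it is exact.
\<close>

lemma divide_denominator:
  fixes f :: "rat fps fps" and m :: nat
  defines "d \<equiv> (1 - fps_s) ^ m * (1 - fps_t) ^ m"
  shows "f / d * d = f"
proof -
  have d0: "fps_nth d 0 = (1 - fps_X) ^ m"
    by (simp add: d_def fps_nth_power_0)
  have unit: "fps_nth d 0 * inverse (fps_nth d 0) = 1"
    unfolding d0 by (rule inverse_mult_eq_1') (simp add: fps_nth_power_0)
  then have "inverse d * d = 1"
    using fps_left_inverse'[of "inverse (fps_nth d 0)" d "inverse (fps_nth d 0)"]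
    by (simp add: fps_inverse_def[of d] mult.commute)
  moreover have "fps_nth d 0 \<noteq> 0"
    using unit by auto
  then have "f / d = f * inverse d"
    by (rule fps_divide_unit)
  ultimately show ?thesis
    by (simp add: mult.assoc)
qed

end

theory Submission
  imports Defs
begin

text \<open>
  Comparing coefficients, both identities say that a binomial coefficient is a sum over the
  factorizations of \<open>\<pi>\<close> of products of two binomial coefficients, and each binomial coefficient
  counts lattice points. Let \<open>Q = 2 * (n + 1)\<close>. The integer sequences
  \<open>0 < z 1 < \<dots> < z n < L * Q\<close> with \<open>z i\<close> congruent to \<open>\<sigma> i\<close> modulo \<open>Q\<close> number
  \<open>(L + n - ades \<sigma>) choose n\<close>; shifting all the residues by \<open>Q / 2\<close> makes them positive, and the
  number becomes \<open>(L + n - 1 - des_A \<sigma>) choose n\<close>. Extended to odd functions, a sequence \<open>y\<close> for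
  \<open>\<sigma>\<close> with \<open>J\<close> periods and a sequence \<open>x\<close> for \<open>\<tau>\<close> with \<open>K\<close> periods are merged into a sequence for
  \<open>\<sigma> \<circ> \<tau>\<close> with \<open>2 * J * K\<close> periods, by replacing in \<open>x = \<tau> + (n + 1) h\<close> the residue \<open>\<tau>\<close> by
  \<open>y \<circ> \<tau>\<close>, which has the same relative order, and rescaling \<open>h\<close>. Conversely, a sequence for \<open>\<pi>\<close>
  determines \<open>h\<close> and \<open>y \<circ> \<tau>\<close> by division with remainder, and sorting the latter recovers \<open>\<tau>\<close>.
\<close>

section \<open>Elementary properties of signed permutations\<close>

lemma hyperoctahedral_permutes:
  "\<pi> \<in> hyperoctahedral n \<Longrightarrow> \<pi> permutes {- int n..int n}"
  by (simp add: hyperoctahedral_def)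

lemma hyperoctahedral_uminus:
  assumes "\<pi> \<in> hyperoctahedral n"
  shows "\<pi> (- i) = - \<pi> i"
proof (cases "i \<in> {- int n..int n}")
  case True
  then show ?thesis using assms by (simp add: hyperoctahedral_def)
next
  case False
  then have "- i \<notin> {- int n..int n}" by auto
  with False show ?thesis
    using permutes_not_in[OF hyperoctahedral_permutes[OF assms]] by metis
qed

lemma hyperoctahedral_abs_le:
  assumes "\<pi> \<in> hyperoctahedral n" "\<bar>i\<bar> \<le> int n"
  shows "\<bar>\<pi> i\<bar> \<le> int n"
proof -
  have "i \<in> {- int n..int n}" using assms(2) by auto
  then have "\<pi> i \<in> {- int n..int n}"
    using permutes_in_image[OF hyperoctahedral_permutes[OF assms(1)]] by blast
  then show ?thesis by auto
qed

lemma hyperoctahedral_eq_iff: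
  assumes "\<pi> \<in> hyperoctahedral n"
  shows "\<pi> i = \<pi> j \<longleftrightarrow> i = j"
  using permutes_inj[OF hyperoctahedral_permutes[OF assms]] by (auto dest: injD)

lemma hyperoctahedral_eq_0_iff:
  assumes "\<pi> \<in> hyperoctahedral n"
  shows "\<pi> i = 0 \<longleftrightarrow> i = 0"
  using hyperoctahedral_eq_iff[OF assms, of i 0] hyperoctahedral_0[OF assms] by simp

lemma hyperoctahedral_compose:
  assumes "\<sigma> \<in> hyperoctahedral n" "\<tau> \<in> hyperoctahedral n"
  shows "\<sigma> \<circ> \<tau> \<in> hyperoctahedral n"
  using permutes_compose[OF assms(2,1)[THEN hyperoctahedral_permutes]]
  by (simp add: hyperoctahedral_def[of n] hyperoctahedral_uminus[OF assms(1)]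
      hyperoctahedral_uminus[OF assms(2)])

lemma hyperoctahedral_inv:
  assumes "\<pi> \<in> hyperoctahedral n"
  shows "inv \<pi> \<in> hyperoctahedral n"
proof -
  have p: "\<pi> permutes {- int n..int n}" by (rule hyperoctahedral_permutes[OF assms])
  have "inv \<pi> (- i) = - inv \<pi> i" for i
  proof -
    have "\<pi> (- inv \<pi> i) = - i"
      by (simp add: hyperoctahedral_uminus[OF assms] permutes_inverses[OF p])
    then show ?thesis using permutes_inverses(2)[OF p] by metis
  qed
  then show ?thesis using permutes_inv[OF p] by (simp add: hyperoctahedral_def)
qed

lemma finite_factorizations: "finite (factorizations n \<pi>)"
proof -
  have "finite (hyperoctahedral n)"
    by (rule finite_subset[OF _ finite_permutations[of "{- int n..int n}"]])
       (auto simp: hyperoctahedral_def)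
  then show ?thesis
    by (auto intro: finite_subset[of _ "hyperoctahedral n \<times> hyperoctahedral n"]
        simp: factorizations_def)
qed

section \<open>Integers compared as pairs of quotient and signed remainder\<close>

text \<open>Two signed remainders can differ by almost \<open>2 * B\<close>, so a quotient gap of 1
  need not decide the comparison. A nonzero even gap contributes at least \<open>2 * B\<close>; if
  one remainder is 0, the difference is below \<open>B\<close> and a gap of 1 suffices.\<close>

lemma less_lex_iff:
  fixes u u' h h' B :: int
  assumes "\<bar>u\<bar> < B" "\<bar>u'\<bar> < B" "2 dvd h - h' \<or> u = 0 \<or> u' = 0"
  shows "u + B * h < u' + B * h' \<longleftrightarrow> h < h' \<or> h = h' \<and> u < u'"
proof -
  have *: "u + B * h < u' + B * h'"
    if "\<bar>u\<bar> < B" "\<bar>u'\<bar> < B" "2 dvd h - h' \<or> u = 0 \<or> u' = 0" "h < h'" for u u' h h' :: int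
  proof (cases "h + 2 \<le> h'")
    case True
    then have "B * (h + 2) \<le> B * h'" using that by (intro mult_left_mono) auto
    then show ?thesis using that by (simp add: algebra_simps)
  next
    case False
    then have h: "h' = h + 1" using that by simp
    then have "u = 0 \<or> u' = 0" using that(3) by auto
    then show ?thesis using that h by (auto simp: algebra_simps)
  qed
  show ?thesis
    using *[of u u' h h'] *[of u' u h' h] assms
    by (smt (verit) dvd_diff_commute)
qed

lemma strict_mono_on_int_Suc:
  fixes f :: "int \<Rightarrow> int"
  assumes "\<And>i. a \<le> i \<Longrightarrow> i < b \<Longrightarrow> f i < f (i + 1)"
  shows "strict_mono_on {a..b} f"
proof (rule strict_mono_onI)
  fix i j assume ij: "i \<in> {a..b}" "j \<in> {a..b}" "i < j"
  have "j \<le> b \<longrightarrow> f i < f j" using \<open>i < j\<close>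
  proof (induction j rule: int_gr_induct)
    case base
    then show ?case using assms[of i] ij by auto
  next
    case (step j)
    then show ?case using assms[of j] ij by auto
  qed
  then show "f i < f j" using ij by simp
qed

section \<open>Odd increasing lifts of a signed permutation\<close>

text \<open>
  The lifts of \<open>\<sigma>\<close> are its words of residues modulo \<open>2 * (n + 1)\<close>, shifted by half a period if
  \<open>e\<close> is odd, lifted to increasing sequences of integers in \<open>L\<close> periods and extended to odd functions.
\<close>

definition lifts :: "nat \<Rightarrow> int \<Rightarrow> (int \<Rightarrow> int) \<Rightarrow> nat \<Rightarrow> (int \<Rightarrow> int) set" where
  "lifts n e \<sigma> L =
     {z. (\<forall>i. z (- i) = - z i) \<and> (\<forall>i>int n. z i = 0) \<and>
         (\<forall>i\<in>{1..int n}. 2 * (int n + 1) dvd z i - \<sigma> i - (int n + 1) * e) \<and>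
         (\<forall>i\<in>{0..<int n}. z i < z (i + 1)) \<and> z (int n) < 2 * (int n + 1) * int L}"

lemma liftsD:
  assumes "z \<in> lifts n e \<sigma> L"
  shows "z (- i) = - z i" "z 0 = 0" "int n < \<bar>i\<bar> \<Longrightarrow> z i = 0"
    "strict_mono_on {- int n..int n} z" "z (int n) < 2 * (int n + 1) * int L"
    "0 \<le> i \<Longrightarrow> i < int n \<Longrightarrow> z i < z (i + 1)"
    "\<bar>i\<bar> \<le> int n \<Longrightarrow> \<bar>z i\<bar> < 2 * (int n + 1) * int L"
proof -
  have odd: "\<And>i. z (- i) = - z i" and out: "\<And>i. int n < i \<Longrightarrow> z i = 0"
    and step: "\<And>i. 0 \<le> i \<Longrightarrow> i < int n \<Longrightarrow> z i < z (i + 1)"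
    and last: "z (int n) < 2 * (int n + 1) * int L"
    using assms by (auto simp: lifts_def)
  show "z (- i) = - z i" by (rule odd)
  show "z 0 = 0" using odd[of 0] by simp
  show "z i = 0" if "int n < \<bar>i\<bar>" using odd[of i] out[of i] out[of "- i"] that by linarith
  show "z (int n) < 2 * (int n + 1) * int L" by (rule last)
  show "0 \<le> i \<Longrightarrow> i < int n \<Longrightarrow> z i < z (i + 1)" by (rule step)
  show mono: "strict_mono_on {- int n..int n} z"
  proof (rule strict_mono_on_int_Suc)
    fix i assume "- int n \<le> i" "i < int n"
    then show "z i < z (i + 1)"
      using step[of i] step[of "- i - 1"] odd[of i] odd[of "i + 1"] by (cases "0 \<le> i") auto
  qed
  show "\<bar>z i\<bar> < 2 * (int n + 1) * int L" if i: "\<bar>i\<bar> \<le> int n"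
  proof -
    have "z i \<le> z (int n)"
      using strict_mono_onD[OF mono, of i "int n"] i by (cases "i = int n") (auto simp: abs_le_iff)
    moreover have "z (- i) \<le> z (int n)"
      using strict_mono_onD[OF mono, of "- i" "int n"] i by (cases "- i = int n") (auto simp: abs_le_iff)
    ultimately show ?thesis using last odd[of i] by linarith
  qed
qed

text \<open>Negating \<open>i\<close> turns the shift \<open>(n + 1) * e\<close> into its negative,
  and the two differ by a multiple of the period \<open>2 * (n + 1)\<close>. Hence the congruence
  survives the odd extension.\<close>

lemma lifts_cong:
  assumes "z \<in> lifts n e \<sigma> L" "\<sigma> \<in> hyperoctahedral n" "\<bar>i\<bar> \<le> int n" "i \<noteq> 0"
  shows "2 * (int n + 1) dvd z i - \<sigma> i - (int n + 1) * e"
proof (cases "i > 0")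
  case True
  then show ?thesis using assms by (auto simp: lifts_def)
next
  case False
  then have "- i \<in> {1..int n}" using assms by auto
  then have "2 * (int n + 1) dvd z (- i) - \<sigma> (- i) - (int n + 1) * e"
    using assms(1) unfolding lifts_def by blast
  moreover have "z i - \<sigma> i - (int n + 1) * e =
      - (z (- i) - \<sigma> (- i) - (int n + 1) * e) + 2 * (int n + 1) * - e"
    by (simp add: liftsD(1)[OF assms(1)] hyperoctahedral_uminus[OF assms(2)] algebra_simps)
  ultimately show ?thesis
    by (metis dvd_add dvd_minus_iff dvd_triv_left)
qed

section \<open>Standardization of odd injective functions\<close>

text \<open>This is the standardization of the word \<open>f (- n), ..., f n\<close>, centred so
  that position 0 gets rank 0 when \<open>f\<close> is odd and injective. The identity outside the
  window follows the convention of \<open>permutes\<close>.\<close>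

definition signed_rank :: "nat \<Rightarrow> (int \<Rightarrow> int) \<Rightarrow> int \<Rightarrow> int" where
  "signed_rank n f i =
     (if \<bar>i\<bar> \<le> int n then int (card {j\<in>{- int n..int n}. f j < f i}) - int n else i)"

lemma signed_rank_less_iff:
  assumes "\<bar>i\<bar> \<le> int n" "\<bar>j\<bar> \<le> int n"
  shows "signed_rank n f i < signed_rank n f j \<longleftrightarrow> f i < f j"
proof -
  have less: "card {k\<in>{- int n..int n}. f k < f i} < card {k\<in>{- int n..int n}. f k < f j}"
    if "f i < f j" "\<bar>i\<bar> \<le> int n" for i j
  proof (rule psubset_card_mono)
    have "i \<in> {- int n..int n}" using that(2) by auto
    moreover have "f k < f j" if "f k < f i" for k
      using that \<open>f i < f j\<close> by (rule order.strict_trans)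
    ultimately show "{k\<in>{- int n..int n}. f k < f i} \<subset> {k\<in>{- int n..int n}. f k < f j}"
      using \<open>f i < f j\<close> by blast
  qed (rule finite_subset[of _ "{- int n..int n}"], auto)
  show ?thesis
  proof (cases "f i = f j")
    case True
    then show ?thesis using assms by (simp add: signed_rank_def)
  next
    case False
    then consider "f i < f j" | "f j < f i" by linarith
    then show ?thesis
    proof cases
      case 1
      then show ?thesis using assms less[of i j] by (simp add: signed_rank_def)
    next
      case 2
      then show ?thesis using assms less[of j i] by (simp add: signed_rank_def)
    qed
  qed
qed

lemma signed_rank_cong:
  assumes "\<And>i j. \<bar>i\<bar> \<le> int n \<Longrightarrow> \<bar>j\<bar> \<le> int n \<Longrightarrow> f i < f j \<longleftrightarrow> g i < g j"
  shows "signed_rank n f = signed_rank n g"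
proof
  fix i
  have "{j\<in>{- int n..int n}. f j < f i} = {j\<in>{- int n..int n}. g j < g i}" if "\<bar>i\<bar> \<le> int n"
    using assms that by auto
  then show "signed_rank n f i = signed_rank n g i" by (simp add: signed_rank_def)
qed

text \<open>Negation exchanges the positions with values below \<open>f (- i)\<close> and those with
  values above \<open>f i\<close>. By injectivity the positions below, above and at \<open>i\<close>
  add up to \<open>2 * n + 1\<close>, which makes the centred rank odd.\<close>

lemma signed_rank_hyperoctahedral:
  assumes odd: "\<And>i. f (- i) = - f i" and inj: "inj_on f {- int n..int n}"
  shows "signed_rank n f \<in> hyperoctahedral n"
proof -
  let ?I = "{- int n..int n}" and ?r = "signed_rank n f"
  have "card {j\<in>?I. f j < f i} < card ?I" if "i \<in> ?I" for i
  proof (rule psubset_card_mono)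
    show "{j\<in>?I. f j < f i} \<subset> ?I" using that by blast
  qed simp
  then have "?r i \<in> ?I" if "i \<in> ?I" for i
    using that by (fastforce simp: signed_rank_def)
  then have range: "?r ` ?I \<subseteq> ?I"
    by (rule image_subsetI)
  have "inj_on ?r ?I"
  proof (rule inj_onI)
    fix i j assume ij: "i \<in> ?I" "j \<in> ?I" "?r i = ?r j"
    then have "\<bar>i\<bar> \<le> int n" "\<bar>j\<bar> \<le> int n" by auto
    then have "f i = f j"
      using ij(3) signed_rank_less_iff[of i n j f] signed_rank_less_iff[of j n i f] by auto
    with ij inj show "i = j" by (auto dest: inj_onD)
  qed
  with range have "bij_betw ?r ?I ?I"
    by (simp add: bij_betw_def endo_inj_surj)
  then have "?r permutes ?I"
    by (rule bij_imp_permutes) (auto simp: signed_rank_def)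
  moreover have "?r (- i) = - ?r i" if i: "i \<in> ?I" for i
  proof -
    have "bij_betw uminus {j\<in>?I. f j < f (- i)} {j\<in>?I. f i < f j}"
      by (rule bij_betwI[where g = uminus]) (auto simp: odd)
    then have "card {j\<in>?I. f j < f (- i)} = card {j\<in>?I. f i < f j}"
      by (rule bij_betw_same_card)
    moreover have "card ?I = card {j\<in>?I. f j < f i} + 1 + card {j\<in>?I. f i < f j}"
    proof -
      define A B where "A = {j\<in>?I. f j < f i}" and "B = {j\<in>?I. f i < f j}"
      have "?I \<subseteq> insert i (A \<union> B)"
      proof
        fix j assume j: "j \<in> ?I"
        show "j \<in> insert i (A \<union> B)"
        proof (cases "j = i")
          case False
          then have "f j \<noteq> f i" using inj_onD[OF inj _ j i] by blast
          then have "f j < f i \<or> f i < f j" by linarith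
          then show ?thesis using j unfolding A_def B_def by blast
        qed simp
      qed
      moreover have "insert i (A \<union> B) \<subseteq> ?I"
        using i unfolding A_def B_def by blast
      ultimately have "?I = insert i (A \<union> B)" by (rule equalityI)
      moreover have "i \<notin> A \<union> B" "A \<inter> B = {}" "finite A" "finite B"
        by (auto simp: A_def B_def intro: finite_subset[of _ ?I])
      ultimately have "card ?I = card A + 1 + card B"
        by (simp only: card_insert_disjoint finite_Un card_Un_disjoint simp_thms)
      then show ?thesis by (simp only: A_def B_def)
    qed
    moreover have "card ?I = 2 * n + 1" by simp
    moreover have "\<bar>i\<bar> \<le> int n" "\<bar>- i\<bar> \<le> int n" using i by auto
    ultimately show ?thesis unfolding signed_rank_def by (simp only: if_True)
  qed
  ultimately show ?thesis by (simp add: hyperoctahedral_def)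
qed

text \<open>\<open>\<tau>\<close> maps the positions counted by the rank bijectively onto the
  \<open>\<tau> i + n\<close> elements of the interval lying below \<open>\<tau> i\<close>.\<close>

lemma signed_rank_id:
  assumes "\<tau> \<in> hyperoctahedral n"
  shows "signed_rank n \<tau> = \<tau>"
proof
  fix i
  let ?I = "{- int n..int n}"
  show "signed_rank n \<tau> i = \<tau> i"
  proof (cases "\<bar>i\<bar> \<le> int n")
    case True
    have p: "\<tau> permutes ?I" by (rule hyperoctahedral_permutes[OF assms])
    have "bij_betw \<tau> {j\<in>?I. \<tau> j < \<tau> i} {j\<in>?I. j < \<tau> i}"
    proof (rule bij_betw_imageI)
      show "inj_on \<tau> {j\<in>?I. \<tau> j < \<tau> i}"
        by (rule inj_on_subset[OF permutes_inj[OF p]]) simp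
      have "\<tau> ` {j\<in>?I. \<tau> j < \<tau> i} = {j \<in> \<tau> ` ?I. j < \<tau> i}" by blast
      then show "\<tau> ` {j\<in>?I. \<tau> j < \<tau> i} = {j\<in>?I. j < \<tau> i}"
        by (simp only: permutes_image[OF p])
    qed
    then have "card {j\<in>?I. \<tau> j < \<tau> i} = card {j\<in>?I. j < \<tau> i}"
      by (rule bij_betw_same_card)
    also have "{j\<in>?I. j < \<tau> i} = {- int n..<\<tau> i}"
      using hyperoctahedral_abs_le[OF assms True] by auto
    finally show ?thesis
      using True hyperoctahedral_abs_le[OF assms True] by (simp add: signed_rank_def)
  next
    case False
    then have "i \<notin> ?I" by auto
    with False show ?thesis
      using permutes_not_in[OF hyperoctahedral_permutes[OF assms], of i]
      by (simp add: signed_rank_def)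
  qed
qed

text \<open>An increasing \<open>y\<close> does not change the relative order, so
  \<open>\<tau>\<close> can be read off from \<open>y \<circ> \<tau>\<close>. This is what makes
  merging injective.\<close>

lemma signed_rank_compose:
  assumes "\<tau> \<in> hyperoctahedral n" "strict_mono_on {- int n..int n} y"
  shows "signed_rank n (y \<circ> \<tau>) = \<tau>"
proof -
  have "signed_rank n (y \<circ> \<tau>) = signed_rank n \<tau>"
  proof (rule signed_rank_cong)
    fix i j assume "\<bar>i\<bar> \<le> int n" "\<bar>j\<bar> \<le> int n"
    from this[THEN hyperoctahedral_abs_le[OF assms(1)]]
    have "\<tau> i \<in> {- int n..int n}" "\<tau> j \<in> {- int n..int n}" by auto
    then show "(y \<circ> \<tau>) i < (y \<circ> \<tau>) j \<longleftrightarrow> \<tau> i < \<tau> j"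
      using strict_mono_on_less[OF assms(2)] by simp
  qed
  then show ?thesis by (simp add: signed_rank_id[OF assms(1)])
qed

section \<open>Merging a pair of lifts\<close>

text \<open>Both chains are lexicographic chains, of the pairs \<open>(h, u)\<close> and
  \<open>(h, v)\<close>, and \<open>u\<close> and \<open>v\<close> have the same relative order. At
  position 0 a zero remainder takes the place of the parity condition, and the final bound is a
  comparison with the pair \<open>(T, 0)\<close>. Merging uses this from \<open>\<tau>\<close> to
  \<open>y \<circ> \<tau>\<close>, its inverse in the other direction.\<close>

lemma lex_increasing_transfer:
  fixes u v h :: "int \<Rightarrow> int" and B C T :: int
  assumes uv: "\<And>i j. \<bar>i\<bar> \<le> int n \<Longrightarrow> \<bar>j\<bar> \<le> int n \<Longrightarrow> u i < u j \<longleftrightarrow> v i < v j"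
    and u: "\<And>i. \<bar>i\<bar> \<le> int n \<Longrightarrow> \<bar>u i\<bar> < B" "u 0 = 0"
    and v: "\<And>i. \<bar>i\<bar> \<le> int n \<Longrightarrow> \<bar>v i\<bar> < C" "v 0 = 0"
    and h: "\<And>i. 0 < i \<Longrightarrow> i \<le> int n \<Longrightarrow> 2 dvd h i - e"
    and inc: "\<And>i. 0 \<le> i \<Longrightarrow> i < int n \<Longrightarrow> u i + B * h i < u (i + 1) + B * h (i + 1)"
    and last: "u (int n) + B * h (int n) < B * T"
  shows "0 \<le> i \<Longrightarrow> i < int n \<Longrightarrow> v i + C * h i < v (i + 1) + C * h (i + 1)"
    and "v (int n) + C * h (int n) < C * T"
proof -
  show "v i + C * h i < v (i + 1) + C * h (i + 1)" if i: "0 \<le> i" "i < int n"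
  proof -
    have abs: "\<bar>i\<bar> \<le> int n" "\<bar>i + 1\<bar> \<le> int n" using i by auto
    have par: "2 dvd h i - h (i + 1) \<or> i = 0"
    proof (cases "i = 0")
      case False
      have "2 dvd (h i - e) - (h (i + 1) - e)"
        using i False by (intro dvd_diff h) auto
      then show ?thesis by simp
    qed simp
    have "h i < h (i + 1) \<or> h i = h (i + 1) \<and> u i < u (i + 1)"
      using less_lex_iff[of "u i" B "u (i + 1)" "h i" "h (i + 1)"] inc[OF i] u abs par by auto
    then show ?thesis
      using less_lex_iff[of "v i" C "v (i + 1)" "h i" "h (i + 1)"] v abs par uv[OF abs] by auto
  qed
  have "0 < B" "0 < C" using u(1)[of 0] v(1)[of 0] by auto
  then have "h (int n) < T \<or> h (int n) = T \<and> u (int n) < 0"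
    using less_lex_iff[of "u (int n)" B 0 "h (int n)" T] last u by simp
  then show "v (int n) + C * h (int n) < C * T"
    using less_lex_iff[of "v (int n)" C 0 "h (int n)" T] v uv[of "int n" 0] u(2) \<open>0 < C\<close> by auto
qed

text \<open>
  The signed permutation \<open>\<tau>\<close> records the relative order of the values of \<open>y \<circ> \<tau>\<close>. Writing
  \<open>x = \<tau> + (n + 1) h\<close>, the lift \<open>x\<close> is ordered like the pairs \<open>(h, \<tau>)\<close>, and so like the pairs
  \<open>(h, y \<circ> \<tau>)\<close>; the latter are merged into the single integer \<open>y \<circ> \<tau> + 2 (n + 1) J h\<close>.
\<close>

definition merge ::
    "nat \<Rightarrow> nat \<Rightarrow> (int \<Rightarrow> int) \<Rightarrow> (int \<Rightarrow> int) \<Rightarrow> (int \<Rightarrow> int) \<Rightarrow> int \<Rightarrow> int" where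
  "merge n J \<tau> y x i = (if \<bar>i\<bar> \<le> int n then y (\<tau> i) + 2 * int J * (x i - \<tau> i) else 0)"

text \<open>The congruence modulo \<open>2 * (n + 1)\<close> says that \<open>x i - \<tau> i\<close>
  is a multiple of half a period, with a factor of the parity of \<open>e\<close>.\<close>

lemma lift_decompose:
  assumes x: "x \<in> lifts n e \<tau> K" and \<tau>: "\<tau> \<in> hyperoctahedral n"
  obtains h where "\<And>i. h (- i) = - h i" "h 0 = 0"
    "\<And>i. \<bar>i\<bar> \<le> int n \<Longrightarrow> x i = \<tau> i + (int n + 1) * h i"
    "\<And>i. \<bar>i\<bar> \<le> int n \<Longrightarrow> i \<noteq> 0 \<Longrightarrow> 2 dvd h i - e"
proof
  define h where "h i = (x i - \<tau> i) div (int n + 1)" for i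
  \<comment> \<open>Outside the window \<open>h\<close> is a rounded quotient and need not be odd;
    reflecting its positive half gives a function that is odd everywhere.\<close>
  define h' where "h' i = (if i < 0 then - h (- i) else h i)" for i
  have *: "x i = \<tau> i + (int n + 1) * h i \<and> 2 dvd h i - e" if i: "\<bar>i\<bar> \<le> int n" "i \<noteq> 0" for i
  proof -
    obtain k where "x i - \<tau> i - (int n + 1) * e = 2 * (int n + 1) * k"
      using lifts_cong[OF x \<tau> i] by blast
    then have k: "x i - \<tau> i = (int n + 1) * (2 * k + e)" by (simp add: algebra_simps)
    then have "h i = 2 * k + e" unfolding h_def by (simp only: k nonzero_mult_div_cancel_left)
    with k show ?thesis by simp
  qed
  have h0: "h 0 = 0"
    by (simp add: h_def liftsD(2)[OF x] hyperoctahedral_0[OF \<tau>])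
  have hh: "h (- i) = - h i" if "\<bar>i\<bar> \<le> int n" for i
  proof (cases "i = 0")
    case False
    have "(int n + 1) * h (- i) = (int n + 1) * (- h i)"
      using *[of i] *[of "- i"] that False liftsD(1)[OF x, of i] hyperoctahedral_uminus[OF \<tau>, of i]
      by auto
    then show ?thesis by (simp only: mult_cancel_left) auto
  qed (simp add: h0)
  have h': "h' i = h i" if "\<bar>i\<bar> \<le> int n" for i
    using hh[of i] that by (simp add: h'_def)
  show "h' (- i) = - h' i" for i using h0 by (auto simp: h'_def)
  show "h' 0 = 0" using h0 by (simp add: h'_def)
  show "x i = \<tau> i + (int n + 1) * h' i" if "\<bar>i\<bar> \<le> int n" for i
    using *[of i] h'[of i] that h0 liftsD(2)[OF x] hyperoctahedral_0[OF \<tau>] by (cases "i = 0") auto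
  show "2 dvd h' i - e" if "\<bar>i\<bar> \<le> int n" "i \<noteq> 0" for i
    using *[of i] h'[of i] that by simp
qed

context
  fixes n J K :: nat and e e' :: int and \<pi> :: "int \<Rightarrow> int"
  assumes \<pi>: "\<pi> \<in> hyperoctahedral n" and n: "n \<ge> 1"
begin

text \<open>Modulo the period the result is \<open>y \<circ> \<tau>\<close>, which has the residues
  of \<open>\<sigma> \<circ> \<tau>\<close> with the shift \<open>e\<close> of \<open>y\<close>; the
  shift \<open>e'\<close> of \<open>x\<close> enters only as the parity of \<open>h\<close>. Order
  and bound carry over from \<open>x\<close> by \<open>lex_increasing_transfer\<close>, with
  \<open>T = 2 * K\<close> and remainder bound \<open>c\<close>.\<close>

lemma merge_lifts:
  assumes \<sigma>: "\<sigma> \<in> hyperoctahedral n" and \<tau>: "\<tau> \<in> hyperoctahedral n" and \<sigma>\<tau>: "\<sigma> \<circ> \<tau> = \<pi>"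
    and y: "y \<in> lifts n e \<sigma> J" and x: "x \<in> lifts n e' \<tau> K"
  shows "merge n J \<tau> y x \<in> lifts n e \<pi> (2 * J * K)"
proof -
  obtain h where h: "\<And>i. h (- i) = - h i" "h 0 = 0"
    "\<And>i. \<bar>i\<bar> \<le> int n \<Longrightarrow> x i = \<tau> i + (int n + 1) * h i"
    "\<And>i. \<bar>i\<bar> \<le> int n \<Longrightarrow> i \<noteq> 0 \<Longrightarrow> 2 dvd h i - e'"
    using lift_decompose[OF x \<tau>] by blast
  define c where "c = 2 * (int n + 1) * int J"
  have m: "merge n J \<tau> y x i = y (\<tau> i) + c * h i" if "\<bar>i\<bar> \<le> int n" for i
    using h(3)[OF that] that by (simp add: merge_def c_def algebra_simps)
  have \<tau>_abs: "\<bar>\<tau> i\<bar> \<le> int n" if "\<bar>i\<bar> \<le> int n" for i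
    by (rule hyperoctahedral_abs_le[OF \<tau> that])
  have inc: "\<tau> i + (int n + 1) * h i < \<tau> (i + 1) + (int n + 1) * h (i + 1)"
    if "0 \<le> i" "i < int n" for i
    using that h(3)[of i] h(3)[of "i + 1"] liftsD(6)[OF x that] by simp
  have last: "\<tau> (int n) + (int n + 1) * h (int n) < (int n + 1) * (2 * int K)"
    using liftsD(5)[OF x] h(3)[of "int n"] by (simp add: algebra_simps)
  have uv: "\<tau> i < \<tau> j \<longleftrightarrow> y (\<tau> i) < y (\<tau> j)" if "\<bar>i\<bar> \<le> int n" "\<bar>j\<bar> \<le> int n" for i j
    using \<tau>_abs[OF that(1)] \<tau>_abs[OF that(2)]
      strict_mono_on_less[OF liftsD(4)[OF y], of "\<tau> i" "\<tau> j"]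
    by (simp add: abs_le_iff)
  have u: "\<bar>\<tau> i\<bar> < int n + 1" if "\<bar>i\<bar> \<le> int n" for i
    using \<tau>_abs[OF that] by simp
  have v: "\<bar>y (\<tau> i)\<bar> < c" if "\<bar>i\<bar> \<le> int n" for i
    unfolding c_def by (rule liftsD(7)[OF y \<tau>_abs[OF that]])
  have h2: "2 dvd h i - e'" if "0 < i" "i \<le> int n" for i
    using h(4)[of i] that by simp
  have \<tau>0: "\<tau> 0 = 0" and y0: "y (\<tau> 0) = 0"
    using hyperoctahedral_0[OF \<tau>] liftsD(2)[OF y] by auto
  note transfer = lex_increasing_transfer[of n \<tau> "\<lambda>i. y (\<tau> i)" "int n + 1" c h e' "2 * int K"]
  have inc': "y (\<tau> i) + c * h i < y (\<tau> (i + 1)) + c * h (i + 1)" if "0 \<le> i" "i < int n" for i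
    by (rule transfer(1)) (rule uv u \<tau>0 v y0 h2 inc last that; assumption)+
  have last': "y (\<tau> (int n)) + c * h (int n) < c * (2 * int K)"
    by (rule transfer(2)) (rule uv u \<tau>0 v y0 h2 inc last; assumption)+
  have "2 * (int n + 1) dvd merge n J \<tau> y x i - \<pi> i - (int n + 1) * e" if i: "1 \<le> i" "i \<le> int n" for i
  proof -
    have "\<bar>\<tau> i\<bar> \<le> int n" "\<tau> i \<noteq> 0"
      using \<tau>_abs[of i] hyperoctahedral_eq_0_iff[OF \<tau>, of i] i by auto
    then have "2 * (int n + 1) dvd y (\<tau> i) - \<sigma> (\<tau> i) - (int n + 1) * e"
      by (rule lifts_cong[OF y \<sigma>])
    moreover have "merge n J \<tau> y x i - \<pi> i - (int n + 1) * e =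
        (y (\<tau> i) - \<sigma> (\<tau> i) - (int n + 1) * e) + 2 * (int n + 1) * (int J * h i)"
      using m[of i] i \<sigma>\<tau> by (auto simp: c_def)
    ultimately show ?thesis by (metis dvd_add dvd_triv_left)
  qed
  moreover have "merge n J \<tau> y x (- i) = - merge n J \<tau> y x i" for i
    using m[of i] m[of "- i"] h(1)[of i] hyperoctahedral_uminus[OF \<tau>, of i] liftsD(1)[OF y, of "\<tau> i"]
    by (cases "\<bar>i\<bar> \<le> int n") (simp_all add: merge_def)
  moreover have "merge n J \<tau> y x i < merge n J \<tau> y x (i + 1)" if "0 \<le> i" "i < int n" for i
    using inc'[OF that] m[of i] m[of "i + 1"] that by simp
  moreover have "merge n J \<tau> y x (int n) < 2 * (int n + 1) * int (2 * J * K)"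
    using last' m[of "int n"] by (simp add: c_def algebra_simps)
  ultimately show ?thesis
    by (auto simp: lifts_def) (auto simp: merge_def)
qed

text \<open>The quotients of both sides have the same parity, so the merged value determines
  quotient and remainder. Ranking the remainders gives \<open>\<tau>\<close>; cancelling
  \<open>\<tau>\<close> gives \<open>\<sigma>\<close> and \<open>y\<close>, and the quotients give
  \<open>x\<close>.\<close>

lemma merge_inj:
  assumes p: "\<sigma> \<in> hyperoctahedral n" "\<tau> \<in> hyperoctahedral n" "\<sigma> \<circ> \<tau> = \<pi>"
      "y \<in> lifts n e \<sigma> J" "x \<in> lifts n e' \<tau> K"
    and p': "\<sigma>' \<in> hyperoctahedral n" "\<tau>' \<in> hyperoctahedral n" "\<sigma>' \<circ> \<tau>' = \<pi>"
      "y' \<in> lifts n e \<sigma>' J" "x' \<in> lifts n e' \<tau>' K"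
    and eq: "merge n J \<tau> y x = merge n J \<tau>' y' x'"
  shows "\<sigma> = \<sigma>' \<and> \<tau> = \<tau>' \<and> y = y' \<and> x = x'"
proof -
  obtain h where h: "\<And>i. h (- i) = - h i" "h 0 = 0"
    "\<And>i. \<bar>i\<bar> \<le> int n \<Longrightarrow> x i = \<tau> i + (int n + 1) * h i"
    "\<And>i. \<bar>i\<bar> \<le> int n \<Longrightarrow> i \<noteq> 0 \<Longrightarrow> 2 dvd h i - e'"
    using lift_decompose[OF p(5,2)] by blast
  obtain h' where h': "\<And>i. h' (- i) = - h' i" "h' 0 = 0"
    "\<And>i. \<bar>i\<bar> \<le> int n \<Longrightarrow> x' i = \<tau>' i + (int n + 1) * h' i"
    "\<And>i. \<bar>i\<bar> \<le> int n \<Longrightarrow> i \<noteq> 0 \<Longrightarrow> 2 dvd h' i - e'"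
    using lift_decompose[OF p'(5,2)] by blast
  define c where "c = 2 * (int n + 1) * int J"
  have *: "h i = h' i \<and> y (\<tau> i) = y' (\<tau>' i)" if i: "\<bar>i\<bar> \<le> int n" for i
  proof -
    have "y (\<tau> i) + c * h i = merge n J \<tau> y x i"
      using h(3)[OF i] i by (simp add: merge_def c_def algebra_simps)
    also have "\<dots> = y' (\<tau>' i) + c * h' i"
      unfolding eq using h'(3)[OF i] i by (simp add: merge_def c_def algebra_simps)
    finally have s: "y (\<tau> i) + c * h i = y' (\<tau>' i) + c * h' i" .
    have b: "\<bar>y (\<tau> i)\<bar> < c" "\<bar>y' (\<tau>' i)\<bar> < c"
      unfolding c_def using liftsD(7)[OF p(4)] liftsD(7)[OF p'(4)]
        hyperoctahedral_abs_le[OF p(2) i] hyperoctahedral_abs_le[OF p'(2) i] by blast+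
    have par: "2 dvd h i - h' i"
    proof (cases "i = 0")
      case False
      have "2 dvd (h i - e') - (h' i - e')"
        using h(4)[OF i False] h'(4)[OF i False] by (rule dvd_diff)
      then show ?thesis by simp
    qed (simp add: h h')
    then have "2 dvd h' i - h i" by (simp add: dvd_diff_commute)
    \<comment> \<open>Equality of the sums excludes both strict lexicographic inequalities, so the
      pairs coincide.\<close>
    with s b par show ?thesis
      using less_lex_iff[of "y (\<tau> i)" c "y' (\<tau>' i)" "h i" "h' i"]
        less_lex_iff[of "y' (\<tau>' i)" c "y (\<tau> i)" "h' i" "h i"] by linarith
  qed
  have "y \<circ> \<tau> = y' \<circ> \<tau>'"
  proof
    fix i show "(y \<circ> \<tau>) i = (y' \<circ> \<tau>') i"
    proof (cases "\<bar>i\<bar> \<le> int n")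
      case False
      then have "i \<notin> {- int n..int n}" by auto
      then have "\<tau> i = i" "\<tau>' i = i"
        using permutes_not_in[OF hyperoctahedral_permutes] p(2) p'(2) by blast+
      then show ?thesis using False liftsD(3)[OF p(4), of i] liftsD(3)[OF p'(4), of i] by simp
    qed (simp add: *)
  qed
  then have \<tau>: "\<tau> = \<tau>'"
    using signed_rank_compose[OF p(2) liftsD(4)[OF p(4)]]
      signed_rank_compose[OF p'(2) liftsD(4)[OF p'(4)]] by simp
  have surj: "surj \<tau>'" by (rule permutes_surj[OF hyperoctahedral_permutes[OF p'(2)]])
  have "y = y'" using \<open>y \<circ> \<tau> = y' \<circ> \<tau>'\<close> surj unfolding \<tau> by (metis surj_fun_eq comp_apply)
  moreover have "\<sigma> = \<sigma>'" using p(3) p'(3) surj unfolding \<tau> by (metis surj_fun_eq comp_apply)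
  moreover have "x = x'"
  proof
    fix i show "x i = x' i"
      using liftsD(3)[OF p(5), of i] liftsD(3)[OF p'(5), of i] h(3)[of i] h'(3)[of i] *[of i] \<tau>
      by (cases "\<bar>i\<bar> \<le> int n") auto
  qed
  ultimately show ?thesis using \<tau> by simp
qed

text \<open>Division by \<open>c\<close> with quotients in the parity class of \<open>e'\<close>
  undoes the merge. The residues of \<open>\<pi>\<close> keep the remainders off the boundary and
  distinct, so that they can be sorted.\<close>

lemma merge_surj:
  assumes v: "v \<in> lifts n e \<pi> (2 * J * K)"
  obtains \<sigma> \<tau> y x where "\<sigma> \<in> hyperoctahedral n" "\<tau> \<in> hyperoctahedral n" "\<sigma> \<circ> \<tau> = \<pi>"
    "y \<in> lifts n e \<sigma> J" "x \<in> lifts n e' \<tau> K" "merge n J \<tau> y x = v"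
proof -
  define c where "c = 2 * (int n + 1) * int J"
  \<comment> \<open>An increasing sequence starting at 0 cannot fit into zero periods, so
    \<open>c\<close> is a valid divisor.\<close>
  have "0 < v (int n)"
    using strict_mono_onD[OF liftsD(4)[OF v], of 0 "int n"] n liftsD(2)[OF v] by simp
  then have "J \<noteq> 0" using liftsD(5)[OF v] by (intro notI) simp
  then have c: "0 < c" by (simp add: c_def)
  \<comment> \<open>Since \<open>0 < \<bar>\<pi> i\<bar> < n + 1\<close>, not even
    \<open>n + 1\<close> divides the sum.\<close>
  have ncong: "\<not> 2 * (int n + 1) dvd \<pi> i + (int n + 1) * e" if "\<bar>i\<bar> \<le> int n" "i \<noteq> 0" for i
  proof
    assume "2 * (int n + 1) dvd \<pi> i + (int n + 1) * e"
    then have "int n + 1 dvd \<pi> i + (int n + 1) * e" by (rule dvd_mult_right)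
    then have "int n + 1 dvd (\<pi> i + (int n + 1) * e) - (int n + 1) * e"
      by (rule dvd_diff) simp
    then have "int n + 1 dvd \<pi> i" by simp
    then show False
      using zdvd_not_zless[of "\<bar>\<pi> i\<bar>" "int n + 1"] hyperoctahedral_abs_le[OF \<pi> that(1)]
        hyperoctahedral_eq_0_iff[OF \<pi>, of i] that(2) by simp
  qed
  \<comment> \<open>\<open>g a\<close> is the integer \<open>q\<close> of the parity of
    \<open>e'\<close> with \<open>- c \<le> a - c * q < c\<close>; dividing by \<open>2 * c\<close>
    rather than \<open>c\<close> is what fixes the parity.\<close>
  define g where "g a = 2 * ((a - c * e' + c) div (2 * c)) + e'" for a
  \<comment> \<open>The remainder interval is half-open, so quotients are taken at positive
    positions only and reflected to obtain an odd function.\<close>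
  define h where "h i = (if \<bar>i\<bar> \<le> int n
      then if i = 0 then 0 else if i < 0 then - g (v (- i)) else g (v i) else 0)" for i
  define \<beta> where "\<beta> i = v i - c * h i" for i
  have h_odd: "h (- i) = - h i" for i by (auto simp: h_def)
  have h_par: "2 dvd h i - e'" if "0 < i" "i \<le> int n" for i
    using that by (simp add: h_def g_def)
  have h0: "h 0 = 0" by (simp add: h_def)
  have \<beta>_odd: "\<beta> (- i) = - \<beta> i" for i
    by (simp add: \<beta>_def h_odd liftsD(1)[OF v])
  have \<beta>0: "\<beta> 0 = 0" by (simp add: \<beta>_def h0 liftsD(2)[OF v])
  have \<beta>_out: "\<beta> i = 0" if "int n < \<bar>i\<bar>" for i
    using that by (simp add: \<beta>_def h_def liftsD(3)[OF v])
  have cong: "2 * (int n + 1) dvd \<beta> i - \<pi> i - (int n + 1) * e" if "\<bar>i\<bar> \<le> int n" "i \<noteq> 0" for i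
  proof -
    have "\<beta> i - \<pi> i - (int n + 1) * e =
        (v i - \<pi> i - (int n + 1) * e) - 2 * (int n + 1) * (int J * h i)"
      by (simp add: \<beta>_def c_def)
    then show ?thesis
      using lifts_cong[OF v \<pi> that] by (metis dvd_diff dvd_triv_left)
  qed
  have \<beta>_pos: "\<bar>\<beta> i\<bar> < c" if i: "0 < i" "i \<le> int n" for i
  proof -
    have "\<beta> i = (v i - c * e' + c) mod (2 * c) - c"
      using i minus_div_mult_eq_mod[of "v i - c * e' + c" "2 * c"]
      by (simp add: \<beta>_def h_def g_def algebra_simps)
    then have *: "- c \<le> \<beta> i" "\<beta> i < c" using c by auto
    \<comment> \<open>As \<open>c\<close> is a multiple of the period, this endpoint would have
      residue 0, which \<open>ncong\<close> rules out.\<close>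
    have "\<beta> i \<noteq> - c"
    proof
      assume "\<beta> i = - c"
      then have "2 * (int n + 1) dvd \<beta> i" by (simp add: c_def)
      moreover have "2 * (int n + 1) dvd \<beta> i - \<pi> i - (int n + 1) * e"
        using cong[of i] i by simp
      ultimately have "2 * (int n + 1) dvd \<beta> i - (\<beta> i - \<pi> i - (int n + 1) * e)"
        by (rule dvd_diff)
      then show False using ncong[of i] i by (simp add: algebra_simps)
    qed
    with * show ?thesis by simp
  qed
  have \<beta>_abs: "\<bar>\<beta> i\<bar> < c" for i
    using \<beta>_pos[of i] \<beta>_pos[of "- i"] \<beta>_odd[of i] \<beta>0 \<beta>_out[of i] c
    by (cases "int n < \<bar>i\<bar>"; cases "i = 0"; cases "0 < i") auto
  \<comment> \<open>Modulo the period, \<open>\<beta> i\<close> is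
    \<open>\<pi> i + (n + 1) * e\<close> for \<open>i\<close> other than 0. These residues are
    nonzero, hence differ from \<open>\<beta> 0\<close>, and they are distinct because values of
    \<open>\<pi>\<close> differ by at most \<open>2 * n\<close>.\<close>
  have inj: "inj_on \<beta> {- int n..int n}"
  proof (rule inj_onI)
    have ne: "\<beta> i \<noteq> 0" if "\<bar>i\<bar> \<le> int n" "i \<noteq> 0" for i
    proof
      assume "\<beta> i = 0"
      then have "\<beta> i - \<pi> i - (int n + 1) * e = - (\<pi> i + (int n + 1) * e)" by simp
      then have "2 * (int n + 1) dvd - (\<pi> i + (int n + 1) * e)"
        using cong[OF that] by (simp only:)
      then show False using ncong[OF that] by (simp only: dvd_minus_iff)
    qed
    fix i j assume ij: "i \<in> {- int n..int n}" "j \<in> {- int n..int n}" "\<beta> i = \<beta> j"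
    then have abs: "\<bar>i\<bar> \<le> int n" "\<bar>j\<bar> \<le> int n" by auto
    show "i = j"
    proof (cases "i = 0 \<or> j = 0")
      case True
      then show ?thesis using ij(3) ne abs \<beta>0 by metis
    next
      case False
      then have "2 * (int n + 1) dvd (\<beta> j - \<pi> j - (int n + 1) * e) - (\<beta> i - \<pi> i - (int n + 1) * e)"
        by (intro dvd_diff[OF cong cong] abs) auto
      then have "2 * (int n + 1) dvd \<pi> i - \<pi> j" by (simp add: ij(3))
      moreover have "\<bar>\<pi> i - \<pi> j\<bar> < 2 * (int n + 1)"
        using order_trans[OF abs_triangle_ineq4 add_mono[OF abs[THEN hyperoctahedral_abs_le[OF \<pi>]]]]
        by (rule le_less_trans) simp
      ultimately have "\<pi> i = \<pi> j"
        using zdvd_not_zless[of "\<bar>\<pi> i - \<pi> j\<bar>" "2 * (int n + 1)"] by fastforce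
      then show ?thesis by (simp add: hyperoctahedral_eq_iff[OF \<pi>])
    qed
  qed
  \<comment> \<open>Sorting the remainders: with \<open>\<tau>\<close> as their rank permutation,
    \<open>\<beta> \<circ> inv \<tau>\<close> is increasing, and \<open>\<tau>\<close> together with
    the quotients \<open>h\<close> rebuilds \<open>x\<close>.\<close>
  define \<tau> where "\<tau> = signed_rank n \<beta>"
  have \<tau>: "\<tau> \<in> hyperoctahedral n"
    unfolding \<tau>_def by (rule signed_rank_hyperoctahedral[OF \<beta>_odd inj])
  note \<tau>p = hyperoctahedral_permutes[OF \<tau>]
  have inv\<tau>: "inv \<tau> \<in> hyperoctahedral n" by (rule hyperoctahedral_inv[OF \<tau>])
  define \<sigma> where "\<sigma> = \<pi> \<circ> inv \<tau>"
  define y where "y = \<beta> \<circ> inv \<tau>"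
  define x where "x i = (if \<bar>i\<bar> \<le> int n then \<tau> i + (int n + 1) * h i else 0)" for i
  have \<sigma>: "\<sigma> \<in> hyperoctahedral n"
    unfolding \<sigma>_def by (rule hyperoctahedral_compose[OF \<pi> inv\<tau>])
  have less: "\<tau> i < \<tau> j \<longleftrightarrow> \<beta> i < \<beta> j" if "\<bar>i\<bar> \<le> int n" "\<bar>j\<bar> \<le> int n" for i j
    unfolding \<tau>_def by (rule signed_rank_less_iff[OF that])
  have inv_abs: "\<bar>inv \<tau> i\<bar> \<le> int n" if "\<bar>i\<bar> \<le> int n" for i
    by (rule hyperoctahedral_abs_le[OF inv\<tau> that])
  show thesis
  proof (rule that[OF \<sigma> \<tau>])
    show "\<sigma> \<circ> \<tau> = \<pi>"
      using permutes_inv_o(2)[OF \<tau>p] by (simp add: \<sigma>_def comp_assoc)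
    have "y (- i) = - y i" for i
      by (simp add: y_def hyperoctahedral_uminus[OF inv\<tau>] \<beta>_odd)
    moreover have "y i = 0" if "i > int n" for i
    proof -
      have "inv \<tau> i = i"
        using permutes_not_in[OF hyperoctahedral_permutes[OF inv\<tau>], of i] that by simp
      then show ?thesis using \<beta>_out[of i] that by (simp add: y_def)
    qed
    moreover have "2 * (int n + 1) dvd y i - \<sigma> i - (int n + 1) * e" if "1 \<le> i" "i \<le> int n" for i
      using cong[of "inv \<tau> i"] inv_abs[of i] that hyperoctahedral_eq_0_iff[OF inv\<tau>, of i]
      by (simp add: y_def \<sigma>_def)
    moreover have "y i < y (i + 1)" if "0 \<le> i" "i < int n" for i
      using less[of "inv \<tau> i" "inv \<tau> (i + 1)"] inv_abs[of i] inv_abs[of "i + 1"] that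
      by (simp add: y_def permutes_inverses[OF \<tau>p])
    moreover have "y (int n) < 2 * (int n + 1) * int J"
      using \<beta>_abs[of "inv \<tau> (int n)"] by (simp add: y_def c_def)
    ultimately show "y \<in> lifts n e \<sigma> J" by (simp add: lifts_def)
    have inc: "\<beta> i + c * h i < \<beta> (i + 1) + c * h (i + 1)" if "0 \<le> i" "i < int n" for i
      using liftsD(6)[OF v that] by (simp add: \<beta>_def)
    have last: "\<beta> (int n) + c * h (int n) < c * (2 * int K)"
      using liftsD(5)[OF v] by (simp add: \<beta>_def c_def algebra_simps)
    have \<tau>_abs: "\<bar>\<tau> i\<bar> < int n + 1" if "\<bar>i\<bar> \<le> int n" for i
      using hyperoctahedral_abs_le[OF \<tau> that] by simp
    note transfer = lex_increasing_transfer[of n \<beta> \<tau> c "int n + 1" h e' "2 * int K"]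
    note \<tau>0 = hyperoctahedral_0[OF \<tau>]
    have inc': "\<tau> i + (int n + 1) * h i < \<tau> (i + 1) + (int n + 1) * h (i + 1)"
      if "0 \<le> i" "i < int n" for i
      by (rule transfer(1))
        (rule less[symmetric] \<beta>_abs \<beta>0 \<tau>_abs \<tau>0 h_par inc last that; assumption)+
    have last': "\<tau> (int n) + (int n + 1) * h (int n) < (int n + 1) * (2 * int K)"
      by (rule transfer(2))
        (rule less[symmetric] \<beta>_abs \<beta>0 \<tau>_abs \<tau>0 h_par inc last; assumption)+
    have "x (- i) = - x i" for i
      by (simp add: x_def h_odd hyperoctahedral_uminus[OF \<tau>])
    moreover have "x i = 0" if "i > int n" for i using that by (simp add: x_def)
    moreover have "2 * (int n + 1) dvd x i - \<tau> i - (int n + 1) * e'" if "1 \<le> i" "i \<le> int n" for i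
    proof -
      have "2 dvd h i - e'" using h_par that by simp
      then have "(int n + 1) * 2 dvd (int n + 1) * (h i - e')" by (rule mult_dvd_mono[OF dvd_refl])
      then show ?thesis using that by (simp add: x_def algebra_simps)
    qed
    moreover have "x i < x (i + 1)" if "0 \<le> i" "i < int n" for i
      using inc'[OF that] that by (simp add: x_def)
    moreover have "x (int n) < 2 * (int n + 1) * int K"
      using last' by (simp add: x_def algebra_simps)
    ultimately show "x \<in> lifts n e' \<tau> K" by (simp add: lifts_def)
    show "merge n J \<tau> y x = v"
    proof
      fix i show "merge n J \<tau> y x i = v i"
        using liftsD(3)[OF v, of i]
        by (cases "\<bar>i\<bar> \<le> int n")
          (simp_all add: merge_def x_def y_def \<beta>_def c_def permutes_inverses[OF \<tau>p] algebra_simps)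
    qed
  qed
qed

text \<open>Merging is a bijection onto the lifts of \<open>\<pi>\<close> from pairs of lifts over
  all factorizations. This is the coefficient form of both identities, with \<open>\<pi>\<close>
  inheriting the shift of the left factor.\<close>

lemma card_lifts_factorizations:
  assumes fin: "\<And>\<sigma>. \<sigma> \<in> hyperoctahedral n \<Longrightarrow> finite (lifts n e \<sigma> J)"
    "\<And>\<tau>. \<tau> \<in> hyperoctahedral n \<Longrightarrow> finite (lifts n e' \<tau> K)"
  shows "card (lifts n e \<pi> (2 * J * K)) =
    (\<Sum>(\<sigma>, \<tau>)\<in>factorizations n \<pi>. card (lifts n e \<sigma> J) * card (lifts n e' \<tau> K))"
proof -
  let ?S = "SIGMA p : factorizations n \<pi>. lifts n e (fst p) J \<times> lifts n e' (snd p) K"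
  have "bij_betw (\<lambda>((\<sigma>, \<tau>), (y, x)). merge n J \<tau> y x) ?S (lifts n e \<pi> (2 * J * K))"
  proof (rule bij_betw_imageI)
    show "inj_on (\<lambda>((\<sigma>, \<tau>), (y, x)). merge n J \<tau> y x) ?S"
    proof (rule inj_onI)
      fix p p' assume p: "p \<in> ?S" "p' \<in> ?S"
        and eq: "(\<lambda>((\<sigma>, \<tau>), (y, x)). merge n J \<tau> y x) p =
          (\<lambda>((\<sigma>, \<tau>), (y, x)). merge n J \<tau> y x) p'"
      obtain \<sigma> \<tau> y x \<sigma>' \<tau>' y' x'
        where [simp]: "p = ((\<sigma>, \<tau>), (y, x))" "p' = ((\<sigma>', \<tau>'), (y', x'))"
        by (metis prod.exhaust)
      have "merge n J \<tau> y x = merge n J \<tau>' y' x'" using eq by simp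
      then have "\<sigma> = \<sigma>' \<and> \<tau> = \<tau>' \<and> y = y' \<and> x = x'"
        by (rule merge_inj[rotated -1]) (use p in \<open>auto simp: factorizations_def\<close>)
      then show "p = p'" by simp
    qed
    show "(\<lambda>((\<sigma>, \<tau>), (y, x)). merge n J \<tau> y x) ` ?S = lifts n e \<pi> (2 * J * K)"
    proof (intro equalityI subsetI)
      fix v assume "v \<in> (\<lambda>((\<sigma>, \<tau>), (y, x)). merge n J \<tau> y x) ` ?S"
      then obtain \<sigma> \<tau> y x where p: "((\<sigma>, \<tau>), (y, x)) \<in> ?S" "v = merge n J \<tau> y x" by auto
      then show "v \<in> lifts n e \<pi> (2 * J * K)"
        using merge_lifts[of \<sigma> \<tau> y x] by (simp add: factorizations_def)
    next
      fix v assume "v \<in> lifts n e \<pi> (2 * J * K)"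
      then obtain \<sigma> \<tau> y x where
        *: "\<sigma> \<in> hyperoctahedral n" "\<tau> \<in> hyperoctahedral n" "\<sigma> \<circ> \<tau> = \<pi>"
          "y \<in> lifts n e \<sigma> J" "x \<in> lifts n e' \<tau> K" "merge n J \<tau> y x = v"
        by (rule merge_surj)
      have "((\<sigma>, \<tau>), (y, x)) \<in> ?S" using * by (simp add: factorizations_def)
      then show "v \<in> (\<lambda>((\<sigma>, \<tau>), (y, x)). merge n J \<tau> y x) ` ?S"
        by (rule rev_image_eqI) (simp add: *(6))
    qed
  qed
  then have "card (lifts n e \<pi> (2 * J * K)) = card ?S"
    by (rule bij_betw_same_card[symmetric])
  also have "\<dots> = (\<Sum>p\<in>factorizations n \<pi>. card (lifts n e (fst p) J \<times> lifts n e' (snd p) K))"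
    using finite_factorizations fin
    by (intro card_SigmaI) (auto simp: factorizations_def)
  finally show ?thesis by (simp add: card_cartesian_product case_prod_unfold)
qed

end

section \<open>Counting lifts by binomial coefficients\<close>

text \<open>An increasing sequence is determined by its image, since the number of smaller elements
  of the image gives the position of a value. Sorting shows that every \<open>n\<close>-subset is
  such an image.\<close>

lemma card_strict_mono_funs:
  fixes n N :: nat
  defines "Y \<equiv> {y :: int \<Rightarrow> int. (\<forall>i. i \<notin> {1..int n} \<longrightarrow> y i = 0) \<and>
      strict_mono_on {1..int n} y \<and> y ` {1..int n} \<subseteq> {1..int N}}"
  shows "card Y = N choose n" "finite Y"
proof -
  let ?I = "{1..int n}"
  have rank: "card {a \<in> y ` ?I. a < y i} = nat (i - 1)" if "y \<in> Y" "i \<in> ?I" for y i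
  proof -
    have mono: "strict_mono_on ?I y" using that(1) by (simp add: Y_def)
    have "{a \<in> y ` ?I. a < y i} = y ` {1..<i}"
      using strict_mono_on_less[OF mono _ that(2)] that(2) by auto
    moreover have "inj_on y {1..<i}"
      by (rule inj_on_subset[OF strict_mono_on_imp_inj_on[OF mono]]) (use that(2) in auto)
    ultimately show ?thesis by (simp add: card_image)
  qed
  have "bij_betw (\<lambda>y. y ` ?I) Y {A. A \<subseteq> {1..int N} \<and> card A = n}"
  proof (rule bij_betw_imageI)
    show "inj_on (\<lambda>y. y ` ?I) Y"
    proof (rule inj_onI, rule ext)
      fix y y' i assume y: "y \<in> Y" "y' \<in> Y" and eq: "y ` ?I = y' ` ?I"
      show "y i = y' i"
      proof (cases "i \<in> ?I")
        case True
        then obtain j where j: "j \<in> ?I" "y i = y' j" using eq by blast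
        then have "nat (i - 1) = nat (j - 1)"
          using rank[OF y(1) True] rank[OF y(2) j(1)] eq by simp
        then have "i = j" using True j(1) by auto
        then show ?thesis using j by simp
      qed (use y in \<open>simp add: Y_def\<close>)
    qed
    show "(\<lambda>y. y ` ?I) ` Y = {A. A \<subseteq> {1..int N} \<and> card A = n}"
    proof (intro equalityI subsetI)
      fix A assume "A \<in> (\<lambda>y. y ` ?I) ` Y"
      then obtain y where "y \<in> Y" "A = y ` ?I" by blast
      then show "A \<in> {A. A \<subseteq> {1..int N} \<and> card A = n}"
        by (simp add: Y_def card_image[OF strict_mono_on_imp_inj_on])
    next
      fix A assume "A \<in> {A. A \<subseteq> {1..int N} \<and> card A = n}"
      then have A: "A \<subseteq> {1..int N}" "card A = n" "finite A"
        using finite_subset[of A "{1..int N}"] by auto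
      define l where "l = sorted_list_of_set A"
      have l: "length l = n" "set l = A" "sorted_wrt (<) l"
        using A by (simp_all add: l_def)
      define y where "y i = (if i \<in> ?I then l ! nat (i - 1) else 0)" for i
      have "y ` ?I = A"
      proof (intro equalityI subsetI)
        fix a assume "a \<in> y ` ?I"
        then show "a \<in> A" using l by (auto simp: y_def)
      next
        fix a assume "a \<in> A"
        then obtain k where "k < n" "a = l ! k" using l by (metis in_set_conv_nth)
        then show "a \<in> y ` ?I" by (intro image_eqI[of _ _ "int k + 1"]) (auto simp: y_def)
      qed
      moreover have "strict_mono_on ?I y"
        by (rule strict_mono_onI) (auto simp: y_def l intro!: sorted_wrt_nth_less[OF l(3)])
      ultimately have "y \<in> Y" using A by (simp add: Y_def y_def)
      then show "A \<in> (\<lambda>y. y ` ?I) ` Y" using \<open>y ` ?I = A\<close> by blast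
    qed
  qed
  then show "card Y = N choose n" "finite Y"
    using n_subsets[of "{1..int N}" n] by (simp_all add: bij_betw_same_card bij_betw_finite)
qed

text \<open>Residues closer than \<open>Q\<close> can influence the comparison only when the
  quotients are equal, and then a descent costs one unit.\<close>

lemma residue_step_iff:
  fixes Q a b w w' :: int
  assumes "\<bar>w - w'\<bar> < Q" "w \<noteq> w'"
  shows "Q * a + w < Q * b + w' \<longleftrightarrow> a + (if w > w' then 1 else 0) \<le> b"
proof (cases "a < b")
  case True
  then have "Q * 1 \<le> Q * (b - a)" using assms by (intro mult_left_mono) auto
  then show ?thesis using True assms by (simp add: algebra_simps)
next
  case False
  show ?thesis
  proof (cases "a = b")
    case False
    then have "Q * 1 \<le> Q * (a - b)" using assms \<open>\<not> a < b\<close> by (intro mult_left_mono) auto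
    then show ?thesis using False assms \<open>\<not> a < b\<close> by (simp add: algebra_simps)
  qed (use assms in auto)
qed

text \<open>
  With \<open>z i = Q * x i + w i\<close>, the inequality \<open>z i < z (i + 1)\<close> means \<open>x i \<le> x (i + 1)\<close>, strictly at the
  descents of \<open>w\<close>. Adding to \<open>x i\<close> the number of ascents of \<open>w\<close> before \<open>i\<close> makes all the inequalities
  strict.
\<close>

lemma card_residue_chains:
  fixes n L :: nat and Q :: int and w :: "int \<Rightarrow> int"
  assumes n: "n \<ge> 1" and w0: "w 0 = 0" "w (int n + 1) = 0"
    and w: "\<And>i. 0 \<le> i \<Longrightarrow> i \<le> int n \<Longrightarrow> \<bar>w i - w (i + 1)\<bar> < Q \<and> w i \<noteq> w (i + 1)"
  defines "d \<equiv> card {i\<in>{0..int n}. w i > w (i + 1)}"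
  defines "Z \<equiv> {z :: int \<Rightarrow> int. (\<forall>i. z (- i) = - z i) \<and> (\<forall>i>int n. z i = 0) \<and>
         (\<forall>i\<in>{1..int n}. Q dvd z i - w i) \<and>
         (\<forall>i\<in>{0..<int n}. z i < z (i + 1)) \<and> z (int n) < Q * int L}"
  assumes d: "d \<le> n"
  shows "card Z = (L + n - d) choose n" "finite Z"
proof -
  let ?I = "{1..int n}" and ?N = "L + n - d"
  define Y where "Y = {y :: int \<Rightarrow> int. (\<forall>i. i \<notin> {1..int n} \<longrightarrow> y i = 0) \<and>
      strict_mono_on {1..int n} y \<and> y ` {1..int n} \<subseteq> {1..int ?N}}"
  define D where "D i = int (card {r\<in>{0..<i}. w r > w (r + 1)})" for i
  have D0: "D 0 = 0" by (simp add: D_def)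
  have DSuc: "D (i + 1) = D i + (if w i > w (i + 1) then 1 else 0)" if "0 \<le> i" for i
  proof -
    have *: "{r\<in>{0..<i + 1}. w r > w (r + 1)} =
      (if w i > w (i + 1) then insert i {r\<in>{0..<i}. w r > w (r + 1)}
       else {r\<in>{0..<i}. w r > w (r + 1)})"
      using that by (auto simp: le_less)
    have "finite {r\<in>{0..<i}. w r > w (r + 1)}" by (rule finite_subset[of _ "{0..<i}"]) auto
    then show ?thesis unfolding D_def * by simp
  qed
  have "{0..<int n + 1} = {0..int n}" by auto
  then have Dn: "D (int n + 1) = int d" by (simp only: D_def d_def)
  have "\<bar>w 0 - w 1\<bar> < Q" using w[of 0] by simp
  then have Q: "Q > 0" by (rule le_less_trans[OF abs_ge_zero])
  have step: "Q * (y i - i + D i) + w i < Q * (y (i + 1) - (i + 1) + D (i + 1)) + w (i + 1)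
      \<longleftrightarrow> y i < y (i + 1)" if "0 \<le> i" "i \<le> int n" for y i
    using w[OF that] by (subst residue_step_iff) (auto simp: DSuc[OF that(1)])
  have iff: "(\<forall>i\<in>{0..<int n}. z i < z (i + 1)) \<and> z (int n) < Q * int L \<longleftrightarrow>
      strict_mono_on ?I y \<and> y ` ?I \<subseteq> {1..int ?N}"
    if y0: "y 0 = 0" and z0: "z 0 = 0" and z: "\<And>i. i \<in> ?I \<Longrightarrow> z i = Q * (y i - i + D i) + w i" for y z
  proof -
    have z': "z i = Q * (y i - i + D i) + w i" if "0 \<le> i" "i \<le> int n" for i
      using z[of i] that y0 z0 D0 w0 by (cases "i = 0") auto
    have "z i < z (i + 1) \<longleftrightarrow> y i < y (i + 1)" if "0 \<le> i" "i < int n" for i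
      using step[of i y] z'[of i] z'[of "i + 1"] that by simp
    then have 1: "(\<forall>i\<in>{0..<int n}. z i < z (i + 1)) \<longleftrightarrow> (\<forall>i\<in>{0..<int n}. y i < y (i + 1))"
      by simp
    \<comment> \<open>The upper bound becomes one more step, from \<open>n\<close> to
      \<open>n + 1\<close>: since \<open>w (n + 1) = 0\<close> and \<open>D (n + 1) = d\<close>, the
      updated value of \<open>y\<close> makes the right side of \<open>step\<close> equal to
      \<open>Q * L\<close>.\<close>
    have "z (int n) < Q * int L \<longleftrightarrow> y (int n) \<le> int ?N"
      using step[of "int n" "y(int n + 1 := int L + int n + 1 - int d)"] z'[of "int n"] d
      by (auto simp: Dn w0)
    moreover have "(\<forall>i\<in>{0..<int n}. y i < y (i + 1)) \<and> y (int n) \<le> int ?N \<longleftrightarrow>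
      strict_mono_on ?I y \<and> y ` ?I \<subseteq> {1..int ?N}" (is "?l \<longleftrightarrow> ?r")
    proof
      assume l: ?l
      then have mono: "strict_mono_on {0..int n} y" by (intro strict_mono_on_int_Suc) auto
      have "0 < y i \<and> y i \<le> int ?N" if "i \<in> ?I" for i
        using strict_mono_onD[OF mono, of 0 i] strict_mono_on_leD[OF mono, of i "int n"] that y0 l
        by auto
      moreover have "strict_mono_on ?I y" by (rule monotone_on_subset[OF mono]) auto
      ultimately show ?r by force
    next
      assume r: ?r
      have "y i < y (i + 1)" if "0 \<le> i" "i < int n" for i
      proof (cases "i = 0")
        case True
        have "y 1 \<in> {1..int ?N}" using r n by (intro subsetD[OF conjunct2[OF r]] imageI) auto
        then show ?thesis using True y0 by simp
      next
        case False
        then show ?thesis using strict_mono_onD[OF conjunct1[OF r], of i "i + 1"] that by simp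
      qed
      moreover have "y (int n) \<in> {1..int ?N}"
        using n by (intro subsetD[OF conjunct2[OF r]] imageI) auto
      ultimately show ?l by simp
    qed
    ultimately show ?thesis using 1 by simp
  qed
  define F where "F z i = (if i \<in> ?I then (z i - w i) div Q + i - D i else 0)" for z i
  \<comment> \<open>The second branch is the first one at \<open>- i\<close>, negated, which
    restores the half of the odd function that \<open>F\<close> forgets.\<close>
  define G where "G y i = (if i \<in> ?I then Q * (y i - i + D i) + w i
      else if - i \<in> ?I then - (Q * (y (- i) + i + D (- i)) + w (- i)) else 0)" for y i
  have "bij_betw F Z Y"
  proof (rule bij_betwI[where g = G])
    show "F \<in> Z \<rightarrow> Y"
    proof
      fix z assume z: "z \<in> Z"
      have "z 0 = 0" using z by (auto simp: Z_def dest: spec[of _ 0])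
      moreover have "z i = Q * (F z i - i + D i) + w i" if "i \<in> ?I" for i
        using z that by (auto simp: Z_def F_def)
      ultimately have "strict_mono_on ?I (F z) \<and> F z ` ?I \<subseteq> {1..int ?N}"
        using iff[of "F z" z] z by (simp add: Z_def F_def)
      then show "F z \<in> Y" by (simp add: Y_def F_def)
    qed
    show "G \<in> Y \<rightarrow> Z"
    proof
      fix y assume y: "y \<in> Y"
      have "(\<forall>i\<in>{0..<int n}. G y i < G y (i + 1)) \<and> G y (int n) < Q * int L"
        by (subst iff[of y "G y"]) (use y in \<open>auto simp: Y_def G_def\<close>)
      then show "G y \<in> Z" unfolding Z_def by (auto simp: G_def)
    qed
    show "G (F z) = z" if z: "z \<in> Z" for z
    proof
      fix i
      have odd: "z (- i) = - z i" for i using z by (simp add: Z_def)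
      have *: "Q * ((z i - w i) div Q) = z i - w i" if "i \<in> ?I" for i
        using z that by (simp add: Z_def)
      have "z i = 0" if "i \<notin> ?I" "- i \<notin> ?I"
      proof (cases "i = 0")
        case True
        then show ?thesis using odd[of 0] by simp
      next
        case False
        then have "i > int n \<or> - i > int n" using that by auto
        then show ?thesis using z odd[of i] by (auto simp: Z_def)
      qed
      then show "G (F z) i = z i"
        using *[of i] *[of "- i"] odd[of i] by (simp add: F_def G_def)
    qed
    show "F (G y) = y" if "y \<in> Y" for y
      using that Q by (auto simp: Y_def F_def G_def fun_eq_iff)
  qed
  then show "card Z = ?N choose n" "finite Z"
    using card_strict_mono_funs[where n = n and N = ?N] unfolding Y_def
    by (simp_all add: bij_betw_same_card bij_betw_finite)
qed

text \<open>Unshifted residues between two zeros form the very word whose descents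
  \<open>ades\<close> counts; neighbours are distinct and differ by less than a period.\<close>

lemma card_lifts_0:
  assumes n: "n \<ge> 1" and \<sigma>: "\<sigma> \<in> hyperoctahedral n"
  shows "card (lifts n 0 \<sigma> L) = (L + n - ades n \<sigma>) choose n" "finite (lifts n 0 \<sigma> L)"
proof -
  let ?w = "\<sigma>(int n + 1 := 0)"
  have d: "card {i\<in>{0..int n}. ?w i > ?w (i + 1)} = ades n \<sigma>"
    by (simp add: ades_def Let_def)
  have eq: "lifts n 0 \<sigma> L = {z :: int \<Rightarrow> int. (\<forall>i. z (- i) = - z i) \<and> (\<forall>i>int n. z i = 0) \<and>
         (\<forall>i\<in>{1..int n}. 2 * (int n + 1) dvd z i - ?w i) \<and>
         (\<forall>i\<in>{0..<int n}. z i < z (i + 1)) \<and> z (int n) < 2 * (int n + 1) * int L}"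
    by (simp add: lifts_def)
  have w: "\<bar>?w i - ?w (i + 1)\<bar> < 2 * (int n + 1) \<and> ?w i \<noteq> ?w (i + 1)" if "0 \<le> i" "i \<le> int n" for i
    using hyperoctahedral_abs_le[OF \<sigma>, of i] hyperoctahedral_abs_le[OF \<sigma>, of "i + 1"]
      hyperoctahedral_eq_iff[OF \<sigma>, of i "i + 1"] hyperoctahedral_eq_0_iff[OF \<sigma>, of i] that n
    by auto
  have w0: "?w 0 = 0" "?w (int n + 1) = 0" using hyperoctahedral_0[OF \<sigma>] by auto
  show "card (lifts n 0 \<sigma> L) = (L + n - ades n \<sigma>) choose n" "finite (lifts n 0 \<sigma> L)"
    using card_residue_chains[OF n w0 w, of L] ades_le[OF \<sigma>] unfolding d eq by auto
qed

text \<open>The shift moves all residues into \<open>1, ..., 2 * n + 1\<close>. The initial 0 then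
  always starts an ascent and the final 0 always ends a descent, so the word has
  \<open>des_A n \<sigma> + 1\<close> descents.\<close>

lemma card_lifts_1:
  assumes n: "n \<ge> 1" and \<sigma>: "\<sigma> \<in> hyperoctahedral n"
  shows "card (lifts n 1 \<sigma> L) = (L + n - 1 - des_A n \<sigma>) choose n" "finite (lifts n 1 \<sigma> L)"
proof -
  define w where "w i = (if 1 \<le> i \<and> i \<le> int n then \<sigma> i + (int n + 1) else 0)" for i
  have w_pos: "0 < w i \<and> w i < 2 * (int n + 1)" if "1 \<le> i" "i \<le> int n" for i
    using hyperoctahedral_abs_le[OF \<sigma>, of i] that by (auto simp: w_def abs_le_iff)
  have "{i\<in>{0..int n}. w i > w (i + 1)} = insert (int n) {i\<in>{1..int n - 1}. \<sigma> i > \<sigma> (i + 1)}"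
  proof (intro set_eqI)
    fix i
    consider "i = 0" | "1 \<le> i" "i \<le> int n - 1" | "i = int n" | "i < 0 \<or> i > int n" by linarith
    then show "i \<in> {i\<in>{0..int n}. w i > w (i + 1)} \<longleftrightarrow>
        i \<in> insert (int n) {i\<in>{1..int n - 1}. \<sigma> i > \<sigma> (i + 1)}"
      using w_pos[of 1] w_pos[of "int n"] n by cases (auto simp: w_def)
  qed
  moreover have "finite {i\<in>{1..int n - 1}. \<sigma> i > \<sigma> (i + 1)}"
    by (rule finite_subset[of _ "{1..int n - 1}"]) auto
  ultimately have d: "card {i\<in>{0..int n}. w i > w (i + 1)} = des_A n \<sigma> + 1"
    by (simp add: des_A_def)
  have eq: "lifts n 1 \<sigma> L = {z :: int \<Rightarrow> int. (\<forall>i. z (- i) = - z i) \<and> (\<forall>i>int n. z i = 0) \<and>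
         (\<forall>i\<in>{1..int n}. 2 * (int n + 1) dvd z i - w i) \<and>
         (\<forall>i\<in>{0..<int n}. z i < z (i + 1)) \<and> z (int n) < 2 * (int n + 1) * int L}"
    by (simp add: lifts_def w_def diff_diff_eq)
  have w: "\<bar>w i - w (i + 1)\<bar> < 2 * (int n + 1) \<and> w i \<noteq> w (i + 1)" if i: "0 \<le> i" "i \<le> int n" for i
  proof -
    consider "i = 0" | "1 \<le> i" "i + 1 \<le> int n" | "i = int n" using i by linarith
    then show ?thesis
    proof cases
      case 1
      then show ?thesis using w_pos[of 1] n by (auto simp: w_def)
    next
      case 2
      then have "w i \<noteq> w (i + 1)"
        using hyperoctahedral_eq_iff[OF \<sigma>, of i "i + 1"] by (auto simp: w_def)
      then show ?thesis using w_pos[of i] w_pos[of "i + 1"] 2 by auto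
    next
      case 3
      then have "w (i + 1) = 0" by (simp add: w_def)
      then show ?thesis using w_pos[of i] 3 n by auto
    qed
  qed
  have w0: "w 0 = 0" "w (int n + 1) = 0" by (simp_all add: w_def)
  have "des_A n \<sigma> + 1 \<le> n" using des_A_le[of n \<sigma>] n by simp
  then show "card (lifts n 1 \<sigma> L) = (L + n - 1 - des_A n \<sigma>) choose n" "finite (lifts n 1 \<sigma> L)"
    using card_residue_chains[OF n w0 w, of L] unfolding d eq by auto
qed

section \<open>From coefficients to power series\<close>

text \<open>Multiplication by \<open>1 - fps_X\<close> takes differences of consecutive
  coefficients, which lowers \<open>n\<close> by Pascal's rule.\<close>

lemma fps_binomial_diagonal:
  "Abs_fps (\<lambda>j. of_nat ((j + n) choose n)) * (1 - fps_X) ^ (n + 1) = (1 :: 'a::comm_ring_1 fps)"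
proof (induction n)
  case 0
  show ?case
    by (rule fps_ext) (simp add: right_diff_distrib)
next
  case (Suc n)
  have "Abs_fps (\<lambda>j. of_nat ((j + Suc n) choose Suc n)) * (1 - fps_X) =
      (Abs_fps (\<lambda>j. of_nat ((j + n) choose n)) :: 'a fps)"
  proof (rule fps_ext)
    fix j
    show "fps_nth (Abs_fps (\<lambda>j. of_nat ((j + Suc n) choose Suc n)) * (1 - fps_X)) j =
      fps_nth (Abs_fps (\<lambda>j. of_nat ((j + n) choose n)) :: 'a fps) j"
      by (cases j) (simp_all add: right_diff_distrib binomial_eq_0)
  qed
  then show ?case using Suc.IH by (simp add: mult.assoc[symmetric])
qed

text \<open>For \<open>j < a\<close> the upper index is below \<open>n\<close> even when the
  subtraction truncates to 0, because \<open>n \<ge> 1\<close>; these coefficients vanish, and the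
  series is a shift by \<open>a\<close>.\<close>

lemma fps_shifted_binomial_diagonal:
  assumes "n \<ge> 1"
  shows "Abs_fps (\<lambda>j. of_nat ((j + n - a) choose n)) * (1 - fps_X) ^ (n + 1) =
    (fps_X ^ a :: 'a::comm_ring_1 fps)"
proof -
  have "Abs_fps (\<lambda>j. of_nat ((j + n - a) choose n)) =
      (fps_X ^ a * Abs_fps (\<lambda>j. of_nat ((j + n) choose n)) :: 'a fps)"
    using assms by (intro fps_ext) (auto simp: fps_X_power_mult_nth binomial_eq_0)
  then show ?thesis
    using fps_binomial_diagonal[of n, where ?'a = 'a] by (simp add: mult.assoc)
qed

text \<open>Each summand is a series in \<open>s\<close> times a series in \<open>t\<close>, and
  each factor clears its own part of the denominator.\<close>

lemma fps2_sum_binomials: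
  assumes n: "n \<ge> 1"
  shows "fps2 (\<lambda>j k. of_nat (\<Sum>p\<in>S. ((j + n - a p) choose n) * ((k + n - b p) choose n))) =
    (\<Sum>p\<in>S. fps_s ^ a p * fps_t ^ b p) / ((1 - fps_s) ^ (n + 1) * (1 - fps_t) ^ (n + 1))"
    (is "?lhs = ?f / ?d")
proof -
  define A where "A m = (Abs_fps (\<lambda>j. of_nat ((j + n - m) choose n)) :: rat fps)" for m
  define B where "B m = (Abs_fps (\<lambda>k. of_nat ((k + n - m) choose n)) :: rat fps fps)" for m
  have "?lhs = (\<Sum>p\<in>S. fps_const (A (a p)) * B (b p))"
    by (intro fps_ext)
      (simp add: fps2_nth A_def B_def fps_sum_nth fps_of_nat[symmetric] fps_mult_right_const_nth)
  also have "\<dots> * ?d = ?f"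
  proof -
    have "fps_const (A m) * (1 - fps_s) ^ (n + 1) = fps_s ^ m" for m
      using fps_shifted_binomial_diagonal[OF n, of m, where ?'a = rat]
      by (simp add: A_def fps_const_1_eq_1[symmetric] del: fps_const_1_eq_1 power_Suc)
    moreover have "B m * (1 - fps_t) ^ (n + 1) = fps_t ^ m" for m
      unfolding B_def by (rule fps_shifted_binomial_diagonal[OF n])
    moreover have "fps_const (A i) * B j * ?d =
        (fps_const (A i) * (1 - fps_s) ^ (n + 1)) * (B j * (1 - fps_t) ^ (n + 1))" for i j
      by (simp only: mult_ac)
    ultimately show ?thesis by (simp only: sum_distrib_right)
  qed
  finally have "?lhs * ?d = ?f / ?d * ?d"
    by (simp only: divide_denominator)
  \<comment> \<open>A nonzero denominator can be cancelled, and a constant coefficient of 1 shows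
    that each base is nonzero.\<close>
  moreover have "?d \<noteq> 0"
  proof -
    have "fps_nth (fps_nth (1 - fps_s) 0) 0 = 1" "fps_nth (1 - fps_t) 0 = 1" by simp_all
    then have "1 - fps_s \<noteq> 0" "1 - fps_t \<noteq> 0" by auto
    then show ?thesis by (simp del: power_Suc)
  qed
  ultimately show ?thesis by (rule mult_right_cancel[THEN iffD1, rotated])
qed

theorem theorem2p7p7:
  fixes n :: nat and \<pi> :: "int \<Rightarrow> int"
  assumes "n \<ge> 1" and "\<pi> \<in> hyperoctahedral n"
  shows
    "fps2 (\<lambda>j k. of_nat ((2 * j * k + 2 * k + n - 1 - des_A n \<pi>) choose n)) =
       (\<Sum>(\<sigma>, \<tau>) \<in> factorizations n \<pi>. fps_s ^ des_A n \<sigma> * fps_t ^ ades n \<tau>) /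
         ((1 - fps_s) ^ (n + 1) * (1 - fps_t) ^ (n + 1)) \<and>
     fps2 (\<lambda>j k. of_nat ((2 * j * k + 2 * j + n - ades n \<pi>) choose n)) =
       (\<Sum>(\<sigma>, \<tau>) \<in> factorizations n \<pi>. fps_s ^ ades n \<sigma> * fps_t ^ des_A n \<tau>) /
         ((1 - fps_s) ^ (n + 1) * (1 - fps_t) ^ (n + 1))"
proof -
  note fin = card_lifts_0(2)[OF assms(1)] card_lifts_1(2)[OF assms(1)]
  have first: "(2 * j * k + 2 * k + n - 1 - des_A n \<pi>) choose n =
      (\<Sum>p\<in>factorizations n \<pi>. ((j + n - des_A n (fst p)) choose n) * ((k + n - ades n (snd p)) choose n))"
    for j k
  proof -
    \<comment> \<open>Here \<open>\<pi>\<close> and \<open>\<sigma>\<close> carry the half-period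
      shift. Giving \<open>\<sigma>\<close> the number \<open>j + 1\<close> of periods absorbs the
      \<open>- 1\<close> in its count and accounts for the term \<open>2 * k\<close>.\<close>
    have "(2 * j * k + 2 * k + n - 1 - des_A n \<pi>) choose n = card (lifts n 1 \<pi> (2 * (j + 1) * k))"
      by (simp add: card_lifts_1(1)[OF assms] algebra_simps)
    also have "\<dots> = (\<Sum>(\<sigma>, \<tau>)\<in>factorizations n \<pi>.
        card (lifts n 1 \<sigma> (j + 1)) * card (lifts n 0 \<tau> k))"
      by (rule card_lifts_factorizations[OF assms(2,1) fin(2,1)])
    also have "\<dots> = (\<Sum>p\<in>factorizations n \<pi>.
        ((j + n - des_A n (fst p)) choose n) * ((k + n - ades n (snd p)) choose n))"
      by (intro sum.cong)
        (auto simp: factorizations_def card_lifts_0(1)[OF assms(1)] card_lifts_1(1)[OF assms(1)])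
    finally show ?thesis .
  qed
  have second: "(2 * j * k + 2 * j + n - ades n \<pi>) choose n =
      (\<Sum>p\<in>factorizations n \<pi>. ((j + n - ades n (fst p)) choose n) * ((k + n - des_A n (snd p)) choose n))"
    for j k
  proof -
    \<comment> \<open>Now \<open>\<tau>\<close> carries the shift and gets \<open>k + 1\<close>
      periods, while \<open>\<pi>\<close> is unshifted like its left factor
      \<open>\<sigma>\<close>.\<close>
    have "(2 * j * k + 2 * j + n - ades n \<pi>) choose n = card (lifts n 0 \<pi> (2 * j * (k + 1)))"
      by (simp add: card_lifts_0(1)[OF assms] algebra_simps)
    also have "\<dots> = (\<Sum>(\<sigma>, \<tau>)\<in>factorizations n \<pi>.
        card (lifts n 0 \<sigma> j) * card (lifts n 1 \<tau> (k + 1)))"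
      by (rule card_lifts_factorizations[OF assms(2,1) fin])
    also have "\<dots> = (\<Sum>p\<in>factorizations n \<pi>.
        ((j + n - ades n (fst p)) choose n) * ((k + n - des_A n (snd p)) choose n))"
      by (intro sum.cong)
        (auto simp: factorizations_def card_lifts_0(1)[OF assms(1)] card_lifts_1(1)[OF assms(1)])
    finally show ?thesis .
  qed
  show ?thesis
    unfolding first second fps2_sum_binomials[OF assms(1)] by (simp only: case_prod_unfold)
qed

end
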